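(* Suppose $\|\mathbf{s}\|\geq1$, let $\mathbf{b}=\mathbf{s}/\|\mathbf{s}\|$, $\mathbf{w}=-\mathbf{b}$, and let $\mathbf{r}\in R$ with $\mathbf{r}\neq\mathbf{b}$ and $\mathbf{r}\neq\mathbf{w}$. Then $(\mathbf{b};t_{\mathbf{b}})$, $(\mathbf{w};t_{\mathbf{w}})$, $(\mathbf{r};t_{\mathbf{r}})$ determine $\mathbf{s}$ uniquely on the ray $L=\{d\mathbf{b}\mid d\geq1\}$: if $\mathbf{x}\in L$ and there is $t'\in\mathbb{R}$ such that $t_{\mathbf{b}}=t'+\|\mathbf{b}-\mathbf{x}\|$, $t_{\mathbf{w}}=t'+\|\mathbf{w}-\mathbf{x}\|$, and $t_{\mathbf{r}}=t'+\|\mathbf{r}-\mathbf{x}\|$, then $\mathbf{x}=\mathbf{s}$.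
   Context: $(X;\|\cdot\|)$ is a real normed space with zero $\theta$, $\dim X\geq2$, whose norm is strictly convex: for all $\mathbf{x}\neq\mathbf{y}$ with $\|\mathbf{x}\|=\|\mathbf{y}\|=1$ and all $\lambda\in(0;1)$, $\|\lambda\mathbf{x}+(1-\lambda)\mathbf{y}\|<1$. The set of sensors is the unit sphere $R=\{\mathbf{u}\in X\mid\|\mathbf{u}\|=1\}$. The source $\mathbf{s}\in X$ and the moment $t_0\in\mathbb{R}$ are fixed, and for $\mathbf{u}\in R$, $t_{\mathbf{u}}=t_0+\|\mathbf{u}-\mathbf{s}\|$. *)

theory Defs
  imports "HOL-Analysis.Analysis"
begin

definition strictly_convex_norm :: "'a::real_normed_vector itself \<Rightarrow> bool" where
  "strictly_convex_norm _ \<longleftrightarrow>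
     (\<forall>x y :: 'a. \<forall>l::real. x \<noteq> y \<longrightarrow> norm x = 1 \<longrightarrow> norm y = 1 \<longrightarrow> 0 < l \<longrightarrow> l < 1 \<longrightarrow>
        norm (l *\<^sub>R x + (1 - l) *\<^sub>R y) < 1)"

(* The library's dim is 0 on infinite-dimensional spaces, which must be admitted here;
   the dimension is therefore read off a Hamel basis, possibly infinite. *)
definition dim_at_least :: "'a::real_vector itself \<Rightarrow> nat \<Rightarrow> bool" where
  "dim_at_least _ n \<longleftrightarrow>
     (\<exists>B :: 'a set. independent B \<and> span B = UNIV \<and> (infinite B \<or> n \<le> card B))"

definition sensors :: "'a::real_normed_vector set" where
  "sensors = {u. norm u = 1}"

(* The moment at which a wave of unit speed, emitted from s at time t0, reaches u. *)
definition arrival_time :: "'a::real_normed_vector \<Rightarrow> real \<Rightarrow> 'a \<Rightarrow> real" where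
  "arrival_time s t0 u = t0 + norm (u - s)"

definition outer_ray :: "'a::real_normed_vector \<Rightarrow> 'a set" where
  "outer_ray b = {d *\<^sub>R b | d::real. d \<ge> 1}"

end

(* Moving the source outwards along the ray from p b to q b changes the arrival time at b, relative
   to the emission, by exactly q - p. At r the change is smaller: equality in the triangle inequality
   norm (r - q b) <= norm (r - p b) + (q - p) would, by strict convexity, put r on the line through b.
   Hence the difference of the arrival times at r and b determines the source. *)
theory Submission
  imports Defs
begin

text \<open>Divided by \<open>norm u + norm v\<close>, the sum \<open>u + v\<close> is the convex
  combination of \<open>sgn u\<close> and \<open>sgn v\<close> with weights proportional to the
  norms. Were these unit vectors distinct, strict convexity would make its norm less than 1, whereas
  equality makes it exactly 1.\<close>

lemma strictly_convex_norm_triangle_eq_imp_sgn_eq: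
  fixes u v :: "'a::real_normed_vector"
  assumes sc: "strictly_convex_norm TYPE('a)"
    and "u \<noteq> 0" "v \<noteq> 0" and eq: "norm (u + v) = norm u + norm v"
  shows "sgn u = sgn v"
proof (rule ccontr)
  assume ne: "sgn u \<noteq> sgn v"
  define k where "k = norm u + norm v"
  have pos: "norm u > 0" "norm v > 0" "k > 0"
    using assms by (auto simp: k_def add_pos_pos)
  define l where "l = norm u / k"
  have l: "0 < l" "l < 1" "1 - l = norm v / k"
    using pos by (auto simp: l_def k_def field_simps)
  have "norm (l *\<^sub>R sgn u + (1 - l) *\<^sub>R sgn v) < 1"
    using sc ne l(1,2) assms(2,3) unfolding strictly_convex_norm_def by (simp add: norm_sgn)
  moreover have "l *\<^sub>R sgn u + (1 - l) *\<^sub>R sgn v = (u + v) /\<^sub>R k"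
    unfolding l(3) using pos by (simp add: l_def sgn_div_norm divide_simps scaleR_add_right)
  ultimately show False
    using eq pos by (simp add: k_def)
qed

text \<open>Equivalently, \<open>norm (r - c *\<^sub>R b) - c\<close> is strictly decreasing in
  \<open>c\<close>, hence injective; this is what identifies the source.\<close>

lemma strictly_convex_norm_distance_along_ray:
  fixes r b :: "'a::real_normed_vector"
  assumes sc: "strictly_convex_norm TYPE('a)"
    and "norm r = 1" "norm b = 1" "r \<noteq> b" "r \<noteq> - b" and pq: "p < q"
  shows "norm (r - q *\<^sub>R b) < norm (r - p *\<^sub>R b) + (q - p)"
proof -
  \<comment> \<open>The line through 0 and \<open>b\<close> meets the unit sphere only in
    \<open>b\<close> and \<open>- b\<close>.\<close>
  have not_multiple: "r \<noteq> c *\<^sub>R b" for c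
  proof
    assume c: "r = c *\<^sub>R b"
    then have "\<bar>c\<bar> = 1" using assms(2,3) by simp
    then show False using c assms(4,5) by (auto simp: abs_if split: if_splits)
  qed
  define u v where "u = r - p *\<^sub>R b" and "v = (p - q) *\<^sub>R b"
  have uv: "u + v = r - q *\<^sub>R b" by (simp add: u_def v_def algebra_simps)
  have nv: "norm v = q - p" using pq assms(3) by (simp add: v_def)
  have "u \<noteq> 0" "v \<noteq> 0" using not_multiple nv pq by (auto simp: u_def)
  have "norm (u + v) \<noteq> norm u + norm v"
  proof
    assume "norm (u + v) = norm u + norm v"
    then have "sgn u = sgn v"
      using strictly_convex_norm_triangle_eq_imp_sgn_eq[OF sc \<open>u \<noteq> 0\<close> \<open>v \<noteq> 0\<close>] by simp
    \<comment> \<open>Since \<open>p < q\<close>, the vector \<open>v\<close> points in the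
      direction \<open>- b\<close>; then so does \<open>u\<close>, which puts \<open>r\<close> on
      the line through \<open>b\<close>.\<close>
    also have "\<dots> = (inverse (q - p) * (p - q)) *\<^sub>R b" by (simp add: sgn_div_norm nv) (simp add: v_def)
    also have "inverse (q - p) * (p - q) = - 1" using pq by (simp add: field_simps)
    also have "- 1 *\<^sub>R b = - b" by simp
    finally have "u = norm u *\<^sub>R (- b)"
      using \<open>u \<noteq> 0\<close> by (metis sgn_div_norm divideR_right norm_eq_zero)
    then have "r = (p - norm u) *\<^sub>R b" by (simp add: u_def algebra_simps)
    then show False using not_multiple by blast
  qed
  then have "norm (u + v) < norm u + norm v"
    using norm_triangle_ineq[of u v] by simp
  then show ?thesis unfolding uv nv by (simp add: u_def)
qed

theorem mainTheorem5:
  fixes s b w r x :: "'a::real_normed_vector" and t0 :: real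
  assumes "dim_at_least TYPE('a) 2"
    and "strictly_convex_norm TYPE('a)"
    and "norm s \<ge> 1"
    and "b = s /\<^sub>R norm s"
    and "w = - b"
    and "r \<in> sensors" and "r \<noteq> b" and "r \<noteq> w"
    and "x \<in> outer_ray b"
    and "\<exists>t'::real. arrival_time s t0 b = t' + norm (b - x)
                  \<and> arrival_time s t0 w = t' + norm (w - x)
                  \<and> arrival_time s t0 r = t' + norm (r - x)"
  shows "x = s"
proof -
  have "s \<noteq> 0" using assms(3) by auto
  then have nb: "norm b = 1" and s: "s = norm s *\<^sub>R b" using assms(4) by simp_all
  obtain d where d: "d \<ge> 1" and x: "x = d *\<^sub>R b"
    using assms(9) by (auto simp: outer_ray_def)
  \<comment> \<open>Being on the ray beyond \<open>b\<close> fixes the sign of \<open>c - 1\<close>,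
    so that the distance to \<open>b\<close> is affine in \<open>c\<close>.\<close>
  have dist_b: "norm (b - c *\<^sub>R b) = c - 1" if "c \<ge> 1" for c
    using that nb by (metis abs_minus_commute abs_of_nonneg diff_ge_0_iff_ge mult.right_neutral
        norm_scaleR scaleR_left_diff_distrib scaleR_one)
  have bs: "norm (b - s) = norm s - 1" using dist_b[OF assms(3)] s by simp
  have bx: "norm (b - x) = d - 1" using dist_b[OF d] x by simp
  \<comment> \<open>Subtracting the equation at \<open>b\<close> from the one at \<open>r\<close>
    eliminates both \<open>t0\<close> and \<open>t'\<close>.\<close>
  have eq: "norm (r - s) - norm s = norm (r - x) - d"
    using assms(10) bs bx by (auto simp: arrival_time_def)
  have less: "norm (r - q *\<^sub>R b) < norm (r - p *\<^sub>R b) + (q - p)" if "p < q" for p q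
    using strictly_convex_norm_distance_along_ray[OF assms(2) _ nb _ _ that] assms(5-8)
    by (simp add: sensors_def)
  \<comment> \<open>If \<open>d\<close> and \<open>norm s\<close> differed, \<open>less\<close> with
    the smaller of them as \<open>p\<close> would contradict \<open>eq\<close>.\<close>
  have "d = norm s"
    using less[of d "norm s"] less[of "norm s" d] eq s x by (cases d "norm s" rule: linorder_cases) auto
  then show ?thesis using s x by simp
qed

end
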